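(* Let $p\geq 2$, let $K\geq 1$ be such that $[0,1]^2$ is partitioned into the collection $\mathcal{C}_K$ of squares of side length $K^{-1}$, and let $F:\mathbb{R}^3\to\mathbb{C}$ with $\mathrm{supp}(\widehat F)\subseteq\mathcal{N}(\delta)$ for some $\delta>0$. Let $B\subseteq\mathbb{R}^3$ be a ball of radius $K^2$. Let $\alpha^*\in\mathcal{C}_K$ satisfy $\|\mathcal{P}_{\alpha^*}F\|_{L^p(B)}=\max_{\alpha\in\mathcal{C}_K}\|\mathcal{P}_\alpha F\|_{L^p(B)}$, and let $$S_{big}=\Big\{\alpha\in\mathcal{C}_K:\|\mathcal{P}_\alpha F\|_{L^p(B)}\geq\frac{1}{100K^2}\|F\|_{L^p(B)}\Big\}.$$ Then at least one of the following holds, with implicit constants independent of $K$, $B$, $F$: (i) $\|F\|_{L^p(B)}\lesssim\max_{\alpha\in\mathcal{C}_K}\|\mathcal{P}_\alpha F\|_{L^p(B)}$; (ii) there is a line $L\subseteq\mathbb{R}^2$ such that $\|F\|_{L^p(B)}\lesssim\big\|\sum_{\alpha\in S_{big},\,\alpha\subseteq S_L}\mathcal{P}_\alpha F\big\|_{L^p(B)}$, where $S_L=\{\xi\in\mathbb{R}^2:\mathrm{dist}(\xi,L)\leq 100K^{-1}\}$; (iii) there are three $K^{-2}$-transverse squares $\alpha_1,\alpha_2,\alpha_3\in\mathcal{C}_K$ such that $\|F\|_{L^p(B)}\lesssim K^2\big(\prod_{i=1}^3\|\mathcal{P}_{\alpha_i}F\|_{L^p(B)}\big)^{1/3}$.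
   Context: $\mathcal{N}(\delta)=\{(\xi,|\xi|^2+t):\xi\in[0,1]^2,t\in[0,\delta]\}\subseteq\mathbb{R}^3$. For $\alpha\subseteq\mathbb{R}^2$, $\mathcal{P}_\alpha$ is the Fourier projection in $\mathbb{R}^3$ onto $\alpha\times\mathbb{R}$: $\widehat{\mathcal{P}_\alpha F}=\widehat F\mathbbm{1}_{\alpha\times\mathbb{R}}$. Squares $Q_1,Q_2,Q_3\subseteq[0,1]^2$ are $\nu$-transverse if for every choice of points $P_i$ on the paraboloid $\{(\xi,|\xi|^2):\xi\in[0,1]^2\}$ whose orthogonal projection onto $[0,1]^2$ lies in $Q_i$, the volume spanned by the unit normals $n(P_1),n(P_2),n(P_3)$ to the paraboloid at these points is larger than $\nu$. *)

theory Defs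
  imports "HOL-Analysis.Analysis"
begin

text \<open>Conventions: R^2 is real \<times> real (frequency variable \<xi>), R^3 is
real \<times> real \<times> real; a frequency point (a, b, c) has \<xi> = (a, b) and height c.\<close>

type_synonym R2 = "real \<times> real"
type_synonym R3 = "real \<times> real \<times> real"

definition Nbhd :: "real \<Rightarrow> R3 set" where
  "Nbhd \<delta> = {(a, b, c). 0 \<le> a \<and> a \<le> 1 \<and> 0 \<le> b \<and> b \<le> 1 \<and>
                         a\<^sup>2 + b\<^sup>2 \<le> c \<and> c \<le> a\<^sup>2 + b\<^sup>2 + \<delta>}"

definition invft :: "(R3 \<Rightarrow> complex) \<Rightarrow> R3 \<Rightarrow> complex" where
  "invft G x = integral\<^sup>L lborel (\<lambda>\<omega>. G \<omega> * cis (2 * pi * (x \<bullet> \<omega>)))"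

text \<open>Fourier projection onto alpha \<times> R, for F = invft G (so that F^ = G).\<close>
definition proj :: "R2 set \<Rightarrow> (R3 \<Rightarrow> complex) \<Rightarrow> R3 \<Rightarrow> complex" where
  "proj \<alpha> G = invft (\<lambda>\<omega>. if (fst \<omega>, fst (snd \<omega>)) \<in> \<alpha> then G \<omega> else 0)"

definition Lpn :: "real \<Rightarrow> R3 set \<Rightarrow> (R3 \<Rightarrow> complex) \<Rightarrow> real" where
  "Lpn p B f = (LINT x:B|lborel. norm (f x) powr p) powr (1 / p)"

definition squares :: "nat \<Rightarrow> R2 set set" where
  "squares K = {{real i / real K .. (real i + 1) / real K} \<times> {real j / real K .. (real j + 1) / real K}
                 | i j. i < K \<and> j < K}"

text \<open>Unit normal to the paraboloid at (\<xi>, |\<xi>|^2).\<close>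
definition unormal :: "R2 \<Rightarrow> R3" where
  "unormal \<xi> = (let s = sqrt (1 + 4 * ((fst \<xi>)\<^sup>2 + (snd \<xi>)\<^sup>2)) in
                 (- 2 * fst \<xi> / s, - 2 * snd \<xi> / s, 1 / s))"

definition det3 :: "R3 \<Rightarrow> R3 \<Rightarrow> R3 \<Rightarrow> real" where
  "det3 u v w = (case u of (u1, u2, u3) \<Rightarrow> case v of (v1, v2, v3) \<Rightarrow> case w of (w1, w2, w3) \<Rightarrow>
      u1 * (v2 * w3 - v3 * w2) - u2 * (v1 * w3 - v3 * w1) + u3 * (v1 * w2 - v2 * w1))"

definition transverse :: "real \<Rightarrow> R2 set \<Rightarrow> R2 set \<Rightarrow> R2 set \<Rightarrow> bool" where
  "transverse \<nu> Q1 Q2 Q3 \<longleftrightarrow>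
     (\<forall>\<xi>1\<in>Q1 \<inter> ({0..1} \<times> {0..1}). \<forall>\<xi>2\<in>Q2 \<inter> ({0..1} \<times> {0..1}). \<forall>\<xi>3\<in>Q3 \<inter> ({0..1} \<times> {0..1}).
        \<bar>det3 (unormal \<xi>1) (unormal \<xi>2) (unormal \<xi>3)\<bar> > \<nu>)"

definition is_line :: "R2 set \<Rightarrow> bool" where
  "is_line L \<longleftrightarrow> (\<exists>a v. v \<noteq> 0 \<and> L = {a + t *\<^sub>R v | t. True})"

definition strip :: "nat \<Rightarrow> R2 set \<Rightarrow> R2 set" where
  "strip K L = {\<xi>. infdist \<xi> L \<le> 100 / real K}"

end

theory Submission
  imports Defs
begin

(* Write F as the sum of the projections P_alpha F over the squares alpha of C_K; the squares
   overlap only on grid lines, which are null sets in frequency space. Convexity of x^p gives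
   ||f_1 + ... + f_n||_p <= n max_i ||f_i||_p, so the at most K^2 squares outside S_big
   contribute at most ||F||_p / 100, and ||F||_p <= 2 ||sum of P_alpha F over S_big||_p.
   Either all squares of S_big lie in the 100/K-strip around one line, which is (ii), or some
   square of S_big leaves the strip around the line through the corners of two squares of S_big
   whose corners are farthest apart. Any three points of these three squares then span a
   triangle of area of order K^-2, and on [0,1]^2 the determinant of the unit normals is at
   least a fixed multiple of that area, so the squares are K^-2-transverse. Each square of S_big
   has ||P_alpha F||_p >= ||F||_p / (100 K^2), and the geometric mean of the three norms
   gives (iii). *)

lemma powr_sum_le_card_powr_sum:
  fixes b :: "'i \<Rightarrow> real"
  assumes S: "finite S" and p: "1 \<le> p" and b: "\<And>i. i \<in> S \<Longrightarrow> 0 \<le> b i"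
  shows "(\<Sum>i\<in>S. b i) powr p \<le> real (card S) powr (p - 1) * (\<Sum>i\<in>S. b i powr p)"
proof -
  \<comment> \<open>\<open>powr_convex\<close> only covers \<open>{0<..}\<close>, so the zero terms are set aside.\<close>
  define S' where "S' = {i\<in>S. 0 < b i}"
  have "finite S'" using S unfolding S'_def by simp
  have sum_S': "(\<Sum>i\<in>S. b i) = (\<Sum>i\<in>S'. b i)"
    unfolding S'_def using S b by (intro sum.mono_neutral_right) (auto simp: less_le)
  show ?thesis
  proof (cases "S' = {}")
    case True
    then show ?thesis using sum_S' by (simp add: sum_nonneg)
  next
    case False
    define m where "m = real (card S')"
    have m: "0 < m" unfolding m_def using False \<open>finite S'\<close> by (simp add: card_gt_0_iff)
    have "(\<Sum>i\<in>S'. (1 / m) *\<^sub>R b i) powr p \<le> (\<Sum>i\<in>S'. 1 / m * b i powr p)"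
      using m by (intro convex_on_sum[OF \<open>finite S'\<close> False powr_convex[OF p]])
        (auto simp: m_def S'_def)
    then have "((\<Sum>i\<in>S'. b i) / m) powr p \<le> (\<Sum>i\<in>S'. b i powr p) / m"
      by (simp add: sum_distrib_left[symmetric] sum_divide_distrib[symmetric])
    then have "(\<Sum>i\<in>S'. b i) powr p \<le> m powr (p - 1) * (\<Sum>i\<in>S'. b i powr p)"
      using m by (simp add: powr_divide sum_nonneg less_imp_le S'_def powr_diff field_simps)
    also have "\<dots> \<le> real (card S) powr (p - 1) * (\<Sum>i\<in>S. b i powr p)"
    proof (rule mult_mono)
      have "card S' \<le> card S" unfolding S'_def using S by (intro card_mono) auto
      then show "m powr (p - 1) \<le> real (card S) powr (p - 1)"
        unfolding m_def using p m by (intro powr_mono2) (auto simp: m_def)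
      show "(\<Sum>i\<in>S'. b i powr p) \<le> (\<Sum>i\<in>S. b i powr p)"
        unfolding S'_def using S by (intro sum_mono2) auto
    qed (auto intro: sum_nonneg)
    finally show ?thesis using sum_S' by simp
  qed
qed

lemma powr_le_imp_le_base:
  fixes x y p :: real
  assumes "0 < p" "0 \<le> y" "x powr p \<le> y powr p"
  shows "x \<le> y"
  using assms powr_less_mono2[of p y x] by (meson not_le)

lemma le_cube_root_prod:
  fixes X a b c :: real
  assumes "0 \<le> X" "X \<le> a" "X \<le> b" "X \<le> c"
  shows "X \<le> (a * b * c) powr (1 / 3)"
proof -
  have cube: "X * X * X = X powr 3"
    using assms(1) by (simp add: powr_numeral power3_eq_cube)
  have "X = (X * X * X) powr (1 / 3)"
    unfolding cube by (subst powr_powr) (simp add: assms(1))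
  also have "\<dots> \<le> (a * b * c) powr (1 / 3)"
    using assms by (intro powr_mono2 mult_mono) auto
  finally show ?thesis .
qed

definition cross2 :: "R2 \<Rightarrow> R2 \<Rightarrow> real" where
  "cross2 u v = fst u * snd v - snd u * fst v"

lemma cross2_add_left: "cross2 (u + w) v = cross2 u v + cross2 w v"
  and cross2_add_right: "cross2 u (v + w) = cross2 u v + cross2 u w"
  by (simp_all add: cross2_def algebra_simps)

lemma cross2_scaleR_left: "cross2 (a *\<^sub>R u) v = a * cross2 u v"
  and cross2_scaleR_right: "cross2 u (a *\<^sub>R v) = a * cross2 u v"
  by (simp_all add: cross2_def algebra_simps)

lemma norm_R2: "norm (u :: R2) = sqrt ((fst u)\<^sup>2 + (snd u)\<^sup>2)"
  by (cases u) (simp add: norm_Pair)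

lemma abs_cross2_le: "\<bar>cross2 u v\<bar> \<le> norm u * norm v"
proof -
  obtain a b c d where uv: "u = (a, b)" "v = (c, d)" by (cases u, cases v)
  have "(a * d - b * c)\<^sup>2 \<le> (a\<^sup>2 + b\<^sup>2) * (c\<^sup>2 + d\<^sup>2)"
  proof -
    have "(a\<^sup>2 + b\<^sup>2) * (c\<^sup>2 + d\<^sup>2) = (a * d - b * c)\<^sup>2 + (a * c + b * d)\<^sup>2"
      by (simp add: power2_eq_square algebra_simps)
    then show ?thesis by simp
  qed
  then have "sqrt ((a * d - b * c)\<^sup>2) \<le> sqrt ((a\<^sup>2 + b\<^sup>2) * (c\<^sup>2 + d\<^sup>2))"
    by (rule real_sqrt_le_mono)
  then show ?thesis by (simp add: uv cross2_def norm_R2 real_sqrt_mult)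
qed

lemma norm_le_of_abs_components:
  fixes d :: R2
  assumes "\<bar>fst d\<bar> \<le> 1" "\<bar>snd d\<bar> \<le> 1"
  shows "norm d \<le> 3 / 2"
proof -
  have "(fst d)\<^sup>2 \<le> 1" "(snd d)\<^sup>2 \<le> 1" using assms abs_square_le_1 by blast+
  then have "(fst d)\<^sup>2 + (snd d)\<^sup>2 \<le> (3 / 2)\<^sup>2" by (simp add: power2_eq_square)
  then show ?thesis unfolding norm_R2 by (rule real_le_lsqrt[rotated]) simp
qed

lemma norm_unit_square_le:
  fixes a :: R2
  assumes "a \<in> {0..1} \<times> {0..1}"
  shows "norm a \<le> 3 / 2"
  using assms by (intro norm_le_of_abs_components) (auto simp: mem_Times_iff)

lemma norm_diff_unit_square_le:
  fixes a b :: R2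
  assumes "a \<in> {0..1} \<times> {0..1}" "b \<in> {0..1} \<times> {0..1}"
  shows "norm (b - a) \<le> 3 / 2"
  using assms by (intro norm_le_of_abs_components) (auto simp: mem_Times_iff)

lemma abs_cross2_perturb_ge:
  fixes V Q f d1 d2 :: R2
  assumes "1 \<le> norm V" "norm Q \<le> norm V" "100 * norm V < \<bar>cross2 V (Q + f)\<bar>"
    and "norm f \<le> 3 / 2" "norm d1 \<le> 3 / 2" "norm d2 \<le> 3 / 2"
  shows "7 \<le> \<bar>cross2 (V + d1) (Q + d2)\<bar>"
proof -
  have bound: "\<bar>cross2 u v\<bar> \<le> a * b" if "norm u \<le> a" "norm v \<le> b" for u v a b
    using abs_cross2_le[of u v] mult_mono[OF that order_trans[OF norm_ge_zero that(1)] norm_ge_zero]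
    by linarith
  have "cross2 (V + d1) (Q + d2) =
      cross2 V (Q + f) - cross2 V f + cross2 V d2 + cross2 d1 Q + cross2 d1 d2"
    by (simp add: cross2_add_left cross2_add_right)
  then show ?thesis
    using bound[OF order_refl[of "norm V"] assms(4)] bound[OF order_refl[of "norm V"] assms(6)]
      bound[OF assms(5) assms(2)] bound[OF assms(5) assms(6)] assms(1,3)
    by linarith
qed

lemma infdist_line_le:
  fixes u v \<xi> :: R2
  assumes "v \<noteq> 0"
  shows "infdist \<xi> {u + t *\<^sub>R v | t. True} \<le> \<bar>cross2 v (\<xi> - u)\<bar> / norm v"
proof -
  define w where "w = \<xi> - u"
  define t where "t = (w \<bullet> v) / (norm v)\<^sup>2"
  have nv: "(norm v)\<^sup>2 > 0" using assms by simp
  have "(norm (w - t *\<^sub>R v))\<^sup>2 = w \<bullet> w - 2 * t * (w \<bullet> v) + t\<^sup>2 * (v \<bullet> v)"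
    unfolding power2_norm_eq_inner
    by (simp add: inner_diff_left inner_diff_right inner_commute power2_eq_square)
  also have "\<dots> = (norm w)\<^sup>2 - (w \<bullet> v)\<^sup>2 / (norm v)\<^sup>2"
    using nv by (simp add: t_def dot_square_norm power2_eq_square field_simps)
  also have "\<dots> = (cross2 v w / norm v)\<^sup>2"
  proof -
    have "(norm w)\<^sup>2 * (norm v)\<^sup>2 = (cross2 v w)\<^sup>2 + (w \<bullet> v)\<^sup>2"
      by (cases v, cases w)
        (simp add: cross2_def norm_R2 inner_prod_def power2_eq_square algebra_simps)
    then show ?thesis using nv by (simp add: field_simps power_divide)
  qed
  finally have "(norm (w - t *\<^sub>R v))\<^sup>2 = (\<bar>cross2 v w\<bar> / norm v)\<^sup>2"
    by (simp add: power_divide)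
  then have "norm (w - t *\<^sub>R v) = \<bar>cross2 v w\<bar> / norm v"
    by (subst (asm) power2_eq_iff_nonneg) auto
  moreover have "infdist \<xi> {u + t *\<^sub>R v | t. True} \<le> dist \<xi> (u + t *\<^sub>R v)"
    by (rule infdist_le) blast
  moreover have "dist \<xi> (u + t *\<^sub>R v) = norm (w - t *\<^sub>R v)"
    by (simp add: w_def dist_norm algebra_simps)
  ultimately show ?thesis by (simp add: w_def)
qed

lemma det3_scaleR: "det3 (a *\<^sub>R u) (b *\<^sub>R v) (c *\<^sub>R w) = a * b * c * det3 u v w"
  by (cases u, cases v, cases w) (simp add: det3_def algebra_simps)

lemma unormal_eq:
  "unormal \<xi> = (1 / sqrt (1 + 4 * (norm \<xi>)\<^sup>2)) *\<^sub>R (- 2 * fst \<xi>, - 2 * snd \<xi>, 1)"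
  by (cases \<xi>) (simp add: unormal_def norm_R2 Let_def)

lemma det3_unormal:
  "det3 (unormal x) (unormal y) (unormal z) =
     4 * cross2 (y - x) (z - x) /
       (sqrt (1 + 4 * (norm x)\<^sup>2) * sqrt (1 + 4 * (norm y)\<^sup>2) * sqrt (1 + 4 * (norm z)\<^sup>2))"
proof -
  have "det3 (- 2 * fst x, - 2 * snd x, 1) (- 2 * fst y, - 2 * snd y, 1)
      (- 2 * fst z, - 2 * snd z, 1) = 4 * cross2 (y - x) (z - x)"
    by (simp add: det3_def cross2_def algebra_simps)
  then show ?thesis unfolding unormal_eq det3_scaleR by simp
qed

lemma abs_det3_unormal_ge:
  assumes "x \<in> {0..1} \<times> {0..1}" "y \<in> {0..1} \<times> {0..1}" "z \<in> {0..1} \<times> {0..1}"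
  shows "4 / 27 * \<bar>cross2 (y - x) (z - x)\<bar> \<le> \<bar>det3 (unormal x) (unormal y) (unormal z)\<bar>"
proof -
  define r where "r \<xi> = sqrt (1 + 4 * (norm \<xi>)\<^sup>2)" for \<xi> :: R2
  have r: "1 \<le> r \<xi>" "r \<xi> \<le> 3" if \<xi>: "\<xi> \<in> {0..1} \<times> {0..1}" for \<xi>
  proof -
    obtain a b where "\<xi> = (a, b)" "0 \<le> a" "a \<le> 1" "0 \<le> b" "b \<le> 1"
      using \<xi> by (cases \<xi>) auto
    moreover have "a\<^sup>2 \<le> 1" "b\<^sup>2 \<le> 1" using calculation by (simp_all add: power_le_one)
    ultimately have "1 + 4 * (norm \<xi>)\<^sup>2 \<le> 3\<^sup>2" by (simp add: norm_R2)
    then show "1 \<le> r \<xi>" "r \<xi> \<le> 3" by (simp_all add: r_def real_le_lsqrt)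
  qed
  note rx = r[OF assms(1)] and ry = r[OF assms(2)] and rz = r[OF assms(3)]
  have pos: "0 < r x * r y * r z" using rx ry rz by simp
  have "r x * r y * r z \<le> 3 * 3 * 3" using rx ry rz by (intro mult_mono) auto
  then have "4 * \<bar>cross2 (y - x) (z - x)\<bar> / 27 \<le> 4 * \<bar>cross2 (y - x) (z - x)\<bar> / (r x * r y * r z)"
    using pos by (intro divide_left_mono) auto
  also have "\<dots> = \<bar>det3 (unormal x) (unormal y) (unormal z)\<bar>"
    using pos by (simp add: det3_unormal r_def abs_mult)
  finally show ?thesis by simp
qed

lemma squares_eq_image:
  "squares K = (\<lambda>(i, j). {real i / real K .. (real i + 1) / real K} \<times>
                          {real j / real K .. (real j + 1) / real K}) ` ({..<K} \<times> {..<K})"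
  unfolding squares_def by auto

lemma finite_squares: "finite (squares K)"
  by (simp add: squares_eq_image)

lemma card_squares_le: "card (squares K) \<le> K\<^sup>2"
proof -
  have "card (squares K) \<le> card ({..<K} \<times> {..<K})"
    unfolding squares_eq_image by (rule card_image_le) simp
  then show ?thesis by (simp add: power2_eq_square)
qed

lemma squares_sets_borel: "\<alpha> \<in> squares K \<Longrightarrow> \<alpha> \<in> sets borel"
  by (auto simp: squares_def intro!: borel_closed closed_Times)

text \<open>Scaling by \<open>K\<close> puts the corners of the squares at integer points.\<close>

definition cell :: "real \<Rightarrow> R2 \<Rightarrow> R2 set" where
  "cell K P = {\<xi>. K *\<^sub>R \<xi> - P \<in> {0..1} \<times> {0..1}}"

lemma squares_eq_cells:
  assumes "1 \<le> K"
  shows "squares K = (\<lambda>(i, j). cell (real K) (real i, real j)) ` ({..<K} \<times> {..<K})"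
proof -
  have "cell (real K) (real i, real j) =
      {real i / real K .. (real i + 1) / real K} \<times> {real j / real K .. (real j + 1) / real K}" for i j
    using assms by (auto simp: cell_def field_simps)
  then show ?thesis unfolding squares_def by auto
qed

lemma one_le_norm_diff_Ints:
  fixes P Q :: R2
  assumes "fst P \<in> \<int>" "snd P \<in> \<int>" "fst Q \<in> \<int>" "snd Q \<in> \<int>" "P \<noteq> Q"
  shows "1 \<le> norm (P - Q)"
proof -
  have "fst (P - Q) \<noteq> 0 \<or> snd (P - Q) \<noteq> 0" using assms(5) by (simp add: prod_eq_iff)
  moreover have "fst (P - Q) \<in> \<int>" "snd (P - Q) \<in> \<int>" using assms(1-4) by simp_all
  ultimately have "1 \<le> \<bar>fst (P - Q)\<bar> \<or> 1 \<le> \<bar>snd (P - Q)\<bar>"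
    by (metis Ints_nonzero_abs_ge1)
  moreover have "\<bar>fst v\<bar> \<le> norm v" "\<bar>snd v\<bar> \<le> norm v" for v :: R2
    using norm_fst_le[of "fst v" "snd v"] norm_snd_le[of "snd v" "fst v"] by simp_all
  ultimately show ?thesis by (meson order_trans)
qed

lemma transverse_cells_of_far:
  fixes P1 P2 P3 \<xi> :: R2
  assumes "0 < K" "1 \<le> norm (P2 - P1)" "norm (P3 - P1) \<le> norm (P2 - P1)" "\<xi> \<in> cell K P3"
    and far: "100 * norm (P2 - P1) < \<bar>cross2 (P2 - P1) (K *\<^sub>R \<xi> - P1)\<bar>"
  shows "transverse (1 / K\<^sup>2) (cell K P1) (cell K P2) (cell K P3)"
  unfolding transverse_def
proof (intro ballI)
  fix x y w
  assume x: "x \<in> cell K P1 \<inter> {0..1} \<times> {0..1}" and y: "y \<in> cell K P2 \<inter> {0..1} \<times> {0..1}"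
    and w: "w \<in> cell K P3 \<inter> {0..1} \<times> {0..1}"
  define a where "a = K *\<^sub>R x - P1"
  define d1 where "d1 = (K *\<^sub>R y - P2) - a"
  define d2 where "d2 = (K *\<^sub>R w - P3) - a"
  have unit: "a \<in> {0..1} \<times> {0..1}" "K *\<^sub>R y - P2 \<in> {0..1} \<times> {0..1}"
      "K *\<^sub>R w - P3 \<in> {0..1} \<times> {0..1}" "K *\<^sub>R \<xi> - P3 \<in> {0..1} \<times> {0..1}"
    using x y w assms(4) by (auto simp: a_def cell_def)
  have "norm d1 \<le> 3 / 2" "norm d2 \<le> 3 / 2" "norm (K *\<^sub>R \<xi> - P3) \<le> 3 / 2"
    using norm_diff_unit_square_le[OF unit(1,2)] norm_diff_unit_square_le[OF unit(1,3)]
      norm_unit_square_le[OF unit(4)]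
    by (simp_all add: d1_def d2_def)
  then have "7 \<le> \<bar>cross2 (P2 - P1 + d1) (P3 - P1 + d2)\<bar>"
    using assms(2,3) far by (intro abs_cross2_perturb_ge[where f = "K *\<^sub>R \<xi> - P3"]) simp_all
  also have "cross2 (P2 - P1 + d1) (P3 - P1 + d2) = K\<^sup>2 * cross2 (y - x) (w - x)"
  proof -
    have "P2 - P1 + d1 = K *\<^sub>R (y - x)" "P3 - P1 + d2 = K *\<^sub>R (w - x)"
      unfolding a_def d1_def d2_def by (simp_all add: algebra_simps)
    then show ?thesis by (simp add: cross2_scaleR_left cross2_scaleR_right power2_eq_square)
  qed
  finally have "7 / K\<^sup>2 \<le> \<bar>cross2 (y - x) (w - x)\<bar>"
    using assms(1) by (simp add: abs_mult field_simps)
  then have "1 / K\<^sup>2 < 4 / 27 * \<bar>cross2 (y - x) (w - x)\<bar>"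
    using assms(1) by (simp add: field_simps)
  also have "\<dots> \<le> \<bar>det3 (unormal x) (unormal y) (unormal w)\<bar>"
    using x y w by (intro abs_det3_unormal_ge) auto
  finally show "1 / K\<^sup>2 < \<bar>det3 (unormal x) (unormal y) (unormal w)\<bar>" .
qed

lemma cells_of_subset_squares:
  assumes K: "1 \<le> K" and S: "S \<subseteq> squares K"
  obtains C where "finite C" "\<And>P. P \<in> C \<Longrightarrow> fst P \<in> \<int> \<and> snd P \<in> \<int>" "S = cell K ` C"
proof
  define C where "C = {P \<in> (\<lambda>(i, j). (real i, real j)) ` ({..<K} \<times> {..<K}). cell K P \<in> S}"
  show "finite C" "\<And>P. P \<in> C \<Longrightarrow> fst P \<in> \<int> \<and> snd P \<in> \<int>" unfolding C_def by auto
  show "S = cell K ` C"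
  proof
    show "S \<subseteq> cell K ` C"
    proof
      fix \<alpha> assume "\<alpha> \<in> S"
      with S obtain i j where "i < K" "j < K" "\<alpha> = cell K (real i, real j)"
        unfolding squares_eq_cells[OF K] by blast
      with \<open>\<alpha> \<in> S\<close> show "\<alpha> \<in> cell K ` C" unfolding C_def by force
    qed
  qed (auto simp: C_def)
qed

lemma finite_farthest_pair:
  fixes C :: "'a::real_normed_vector set"
  assumes "finite C" "C \<noteq> {}"
  obtains P1 P2 where "P1 \<in> C" "P2 \<in> C"
    "\<And>Q1 Q2. Q1 \<in> C \<Longrightarrow> Q2 \<in> C \<Longrightarrow> norm (Q2 - Q1) \<le> norm (P2 - P1)"
proof -
  define f :: "'a \<times> 'a \<Rightarrow> real" where "f = (\<lambda>(Q1, Q2). norm (Q2 - Q1))"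
  have fin: "finite (C \<times> C)" using assms(1) by simp
  have "Max (f ` (C \<times> C)) \<in> f ` (C \<times> C)" using fin assms(2) by (intro Max_in) auto
  then obtain P1 P2 where P12: "P1 \<in> C" "P2 \<in> C" "Max (f ` (C \<times> C)) = f (P1, P2)"
    by auto
  have "norm (Q2 - Q1) \<le> norm (P2 - P1)" if "Q1 \<in> C" "Q2 \<in> C" for Q1 Q2
  proof -
    have "f (Q1, Q2) \<le> Max (f ` (C \<times> C))" using that by (intro Max_ge finite_imageI fin) auto
    then show ?thesis using P12(3) by (simp add: f_def)
  qed
  with P12(1,2) show ?thesis by (rule that)
qed

lemma cross2_gt_of_infdist_line_gt:
  fixes V P \<xi> :: R2
  assumes "0 < K" "V \<noteq> 0" "r / K < infdist \<xi> {(1 / K) *\<^sub>R P + t *\<^sub>R V | t. True}"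
  shows "r * norm V < \<bar>cross2 V (K *\<^sub>R \<xi> - P)\<bar>"
proof -
  note assms(3)
  also have "infdist \<xi> {(1 / K) *\<^sub>R P + t *\<^sub>R V | t. True} \<le>
      \<bar>cross2 V (\<xi> - (1 / K) *\<^sub>R P)\<bar> / norm V"
    using assms(2) by (rule infdist_line_le)
  also have "\<xi> - (1 / K) *\<^sub>R P = (1 / K) *\<^sub>R (K *\<^sub>R \<xi> - P)"
    using assms(1) by (simp add: algebra_simps)
  also have "\<bar>cross2 V ((1 / K) *\<^sub>R (K *\<^sub>R \<xi> - P))\<bar> / norm V =
      (\<bar>cross2 V (K *\<^sub>R \<xi> - P)\<bar> / norm V) / K"
    using assms(1) by (simp add: cross2_scaleR_right abs_mult)
  finally have "r < \<bar>cross2 V (K *\<^sub>R \<xi> - P)\<bar> / norm V"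
    using assms(1) by (subst (asm) divide_less_cancel) simp
  then show ?thesis using assms(2) by (simp add: pos_less_divide_eq)
qed

text \<open>Take two squares of \<open>S\<close> whose corners are farthest apart and the line through these
  corners; a square leaving the strip around it forms a transverse triple with them. If the two
  corners coincide, \<open>S\<close> is a single square and any line through its corner will do.\<close>

lemma squares_in_strip_or_transverse:
  assumes K: "1 \<le> K" and S: "S \<subseteq> squares K"
  shows "(\<exists>L. is_line L \<and> (\<forall>\<alpha>\<in>S. \<alpha> \<subseteq> strip K L)) \<or>
         (\<exists>\<alpha>1\<in>S. \<exists>\<alpha>2\<in>S. \<exists>\<alpha>3\<in>S. transverse (1 / real K ^ 2) \<alpha>1 \<alpha>2 \<alpha>3)"
proof -
  obtain C where C: "finite C" "\<And>P. P \<in> C \<Longrightarrow> fst P \<in> \<int> \<and> snd P \<in> \<int>" "S = cell K ` C"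
    using cells_of_subset_squares[OF K S] by blast
  show ?thesis
  proof (cases "C = {}")
    case True
    have "is_line {0 + t *\<^sub>R (1, 0) | t. True}"
      unfolding is_line_def by (intro exI[of _ 0] exI[of _ "(1, 0)"]) (simp add: zero_prod_def)
    then show ?thesis using True C(3) by blast
  next
    case False
    then obtain P1 P2 where P12: "P1 \<in> C" "P2 \<in> C"
      and max: "\<And>Q1 Q2. Q1 \<in> C \<Longrightarrow> Q2 \<in> C \<Longrightarrow> norm (Q2 - Q1) \<le> norm (P2 - P1)"
      using finite_farthest_pair[OF C(1)] by blast
    define V :: R2 where "V = (if P1 = P2 then (1, 0) else P2 - P1)"
    have "V \<noteq> 0" by (auto simp: V_def prod_eq_iff)
    define L where "L = {(1 / real K) *\<^sub>R P1 + t *\<^sub>R V | t. True}"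
    have line: "is_line L" unfolding L_def is_line_def using \<open>V \<noteq> 0\<close> by blast
    show ?thesis
    proof (cases "\<forall>\<alpha>\<in>S. \<alpha> \<subseteq> strip K L")
      case True
      then show ?thesis using line by blast
    next
      case False
      then obtain P3 \<xi> where P3: "P3 \<in> C" "\<xi> \<in> cell K P3" "\<not> infdist \<xi> L \<le> 100 / real K"
        unfolding strip_def C(3) by blast
      then have far: "100 * norm V < \<bar>cross2 V (real K *\<^sub>R \<xi> - P1)\<bar>"
        using K \<open>V \<noteq> 0\<close> unfolding L_def by (intro cross2_gt_of_infdist_line_gt) auto
      have "P1 \<noteq> P2"
      proof
        assume "P1 = P2"
        then have "P3 = P1" using max[OF P12(1) P3(1)] by simp
        then have "norm (real K *\<^sub>R \<xi> - P1) \<le> 3 / 2"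
          using P3(2) by (intro norm_unit_square_le) (simp add: cell_def)
        then have "norm V * norm (real K *\<^sub>R \<xi> - P1) \<le> norm V * (3 / 2)"
          by (intro mult_left_mono) simp_all
        moreover have "0 < norm V" using \<open>V \<noteq> 0\<close> by simp
        ultimately show False using far abs_cross2_le[of V "real K *\<^sub>R \<xi> - P1"] by linarith
      qed
      then have "V = P2 - P1" "1 \<le> norm (P2 - P1)"
        using one_le_norm_diff_Ints C(2)[OF P12(1)] C(2)[OF P12(2)] by (auto simp: V_def)
      then have "transverse (1 / (real K)\<^sup>2) (cell K P1) (cell K P2) (cell K P3)"
        using K max[OF P12(1) P3(1)] P3(2) far by (intro transverse_cells_of_far) auto
      then show ?thesis using P12 P3(1) unfolding C(3) by blast
    qed
  qed
qed

lemma unique_grid_index: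
  fixes K :: nat and a :: real
  assumes "1 \<le> K" "0 \<le> a" "a \<le> 1" and off: "\<forall>i::nat. real K * a \<noteq> real i"
  shows "\<exists>!i. i < K \<and> real K * a - real i \<in> {0..1}"
proof
  define i0 where "i0 = nat \<lfloor>real K * a\<rfloor>"
  have "real i0 = of_int \<lfloor>real K * a\<rfloor>" unfolding i0_def using assms(2) by simp
  then have i0: "real i0 \<le> real K * a" "real K * a < real i0 + 1"
    by (simp_all add: floor_less_iff)
  have "real K * a < real K" using off[rule_format, of K] assms(1,3) by (simp add: less_le)
  then show "i0 < K \<and> real K * a - real i0 \<in> {0..1}" using i0 by auto
  fix i assume i: "i < K \<and> real K * a - real i \<in> {0..1}"
  have "real K * a \<noteq> real i" "real K * a \<noteq> real (Suc i)" using off by blast+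
  then have "real i < real K * a" "real K * a < real i + 1" using i by auto
  then have "\<lfloor>real K * a\<rfloor> = int i" by (intro floor_unique) auto
  then show "i = i0" by (simp add: i0_def)
qed

lemma card_squares_containing:
  assumes K: "1 \<le> K" and "\<xi> \<in> {0..1} \<times> {0..1}"
    and "\<forall>i::nat. real K * fst \<xi> \<noteq> real i" "\<forall>i::nat. real K * snd \<xi> \<noteq> real i"
  shows "card {\<alpha> \<in> squares K. \<xi> \<in> \<alpha>} = 1"
proof -
  obtain i0 where i0: "\<And>i. i < K \<and> real K * fst \<xi> - real i \<in> {0..1} \<longleftrightarrow> i = i0"
    using unique_grid_index[OF K, of "fst \<xi>"] assms(2,3) by (auto simp: mem_Times_iff)
  obtain j0 where j0: "\<And>j. j < K \<and> real K * snd \<xi> - real j \<in> {0..1} \<longleftrightarrow> j = j0"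
    using unique_grid_index[OF K, of "snd \<xi>"] assms(2,4) by (auto simp: mem_Times_iff)
  have "{\<alpha> \<in> squares K. \<xi> \<in> \<alpha>} = {cell K (real i0, real j0)}"
  proof (intro equalityI subsetI)
    fix \<alpha> assume "\<alpha> \<in> {\<alpha> \<in> squares K. \<xi> \<in> \<alpha>}"
    then obtain i j where "i < K" "j < K" "\<alpha> = cell K (real i, real j)" "\<xi> \<in> \<alpha>"
      unfolding squares_eq_cells[OF K] by auto
    moreover from this have "i = i0" "j = j0"
      using i0[of i] j0[of j] by (simp_all add: cell_def mem_Times_iff)
    ultimately show "\<alpha> \<in> {cell K (real i0, real j0)}" by simp
  next
    fix \<alpha> assume "\<alpha> \<in> {cell K (real i0, real j0)}"
    moreover have "i0 < K" "j0 < K" "\<xi> \<in> cell K (real i0, real j0)"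
      using i0[of i0] j0[of j0] by (simp_all add: cell_def mem_Times_iff)
    ultimately show "\<alpha> \<in> {\<alpha> \<in> squares K. \<xi> \<in> \<alpha>}"
      unfolding squares_eq_cells[OF K] by auto
  qed
  then show ?thesis by simp
qed

definition Lp_on :: "real \<Rightarrow> R3 set \<Rightarrow> (R3 \<Rightarrow> complex) \<Rightarrow> bool" where
  "Lp_on p B f \<longleftrightarrow> f \<in> borel_measurable lborel \<and> set_integrable lborel B (\<lambda>x. norm (f x) powr p)"

lemma Lp_on_bounded:
  assumes "B \<in> sets lborel" "emeasure lborel B < \<infinity>" "0 < p"
    and "f \<in> borel_measurable lborel" "bounded (range f)"
  shows "Lp_on p B f"
proof -
  obtain M where M: "\<And>x. norm (f x) \<le> M" using assms(5) by (auto simp: bounded_iff)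
  have "(\<lambda>x. norm (f x) powr p) \<in> borel_measurable lborel" using assms(4) by measurable
  then have "set_integrable lborel B (\<lambda>x. norm (f x) powr p)"
    unfolding set_integrable_def
    using assms M by (intro integrableI_bounded_set_indicator[where B = "M powr p"])
      (auto intro!: powr_mono2)
  then show ?thesis using assms(4) by (simp add: Lp_on_def)
qed

lemma Lpn_nonneg: "0 \<le> Lpn p B f"
  by (simp add: Lpn_def)

lemma Lpn_powr:
  assumes "0 < p"
  shows "Lpn p B f powr p = (LINT x:B|lborel. norm (f x) powr p)"
proof -
  have "0 \<le> (LINT x:B|lborel. norm (f x) powr p)"
    unfolding set_lebesgue_integral_def by (rule integral_nonneg_AE) (auto simp: indicator_def)
  then show ?thesis using assms by (simp add: Lpn_def powr_powr)
qed

lemma set_integral_sum: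
  fixes f :: "'i \<Rightarrow> 'a \<Rightarrow> real"
  assumes "finite S" "\<And>i. i \<in> S \<Longrightarrow> set_integrable M A (f i)"
  shows "set_integrable M A (\<lambda>x. \<Sum>i\<in>S. f i x)"
    and "(LINT x:A|M. \<Sum>i\<in>S. f i x) = (\<Sum>i\<in>S. LINT x:A|M. f i x)"
proof -
  have "integrable M (\<lambda>x. indicator A x *\<^sub>R f i x)" if "i \<in> S" for i
    using assms(2)[OF that] unfolding set_integrable_def .
  then show "set_integrable M A (\<lambda>x. \<Sum>i\<in>S. f i x)"
    and "(LINT x:A|M. \<Sum>i\<in>S. f i x) = (\<Sum>i\<in>S. LINT x:A|M. f i x)"
    unfolding set_integrable_def set_lebesgue_integral_def scaleR_sum_right
    by (auto intro!: Bochner_Integration.integrable_sum Bochner_Integration.integral_sum)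
qed

lemma norm_sum_powr_le:
  fixes f :: "'i \<Rightarrow> 'a \<Rightarrow> 'b::real_normed_vector"
  assumes "finite S" "1 \<le> p"
  shows "norm (\<Sum>i\<in>S. f i x) powr p \<le> real (card S) powr (p - 1) * (\<Sum>i\<in>S. norm (f i x) powr p)"
proof -
  have "norm (\<Sum>i\<in>S. f i x) powr p \<le> (\<Sum>i\<in>S. norm (f i x)) powr p"
    using assms by (intro powr_mono2 norm_sum) auto
  also have "\<dots> \<le> real (card S) powr (p - 1) * (\<Sum>i\<in>S. norm (f i x) powr p)"
    using assms by (intro powr_sum_le_card_powr_sum) auto
  finally show ?thesis .
qed

lemma
  assumes "finite S" "1 \<le> p" "B \<in> sets lborel" "\<And>i. i \<in> S \<Longrightarrow> Lp_on p B (f i)"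
  shows Lp_on_sum: "Lp_on p B (\<lambda>x. \<Sum>i\<in>S. f i x)"
    and Lpn_sum_powr_le:
      "Lpn p B (\<lambda>x. \<Sum>i\<in>S. f i x) powr p \<le> real (card S) powr (p - 1) * (\<Sum>i\<in>S. Lpn p B (f i) powr p)"
proof -
  have p: "0 < p" using assms(2) by simp
  have int: "set_integrable lborel B (\<lambda>x. norm (f i x) powr p)" if "i \<in> S" for i
    using assms(4)[OF that] by (simp add: Lp_on_def)
  have int_sum:
    "set_integrable lborel B (\<lambda>x. real (card S) powr (p - 1) * (\<Sum>i\<in>S. norm (f i x) powr p))"
    using set_integral_sum(1)[OF assms(1) int] by (rule set_integrable_mult_right)
  have meas: "(\<lambda>x. \<Sum>i\<in>S. f i x) \<in> borel_measurable lborel"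
    using assms(4) unfolding Lp_on_def by (intro borel_measurable_sum) auto
  have "set_integrable lborel B (\<lambda>x. norm (\<Sum>i\<in>S. f i x) powr p)"
    using int_sum unfolding set_borel_measurable_def
  proof (rule set_integrable_bound)
    show "set_borel_measurable lborel B (\<lambda>x. norm (\<Sum>i\<in>S. f i x) powr p)"
      using meas assms(3) unfolding set_borel_measurable_def by measurable
    show "AE x in lborel. x \<in> B \<longrightarrow> norm (norm (\<Sum>i\<in>S. f i x) powr p) \<le>
        norm (real (card S) powr (p - 1) * (\<Sum>i\<in>S. norm (f i x) powr p))"
      using norm_sum_powr_le[OF assms(1,2)] by (auto intro!: AE_I2 order_trans[OF _ abs_ge_self])
  qed
  then show sum: "Lp_on p B (\<lambda>x. \<Sum>i\<in>S. f i x)" using meas by (simp add: Lp_on_def)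
  have "Lpn p B (\<lambda>x. \<Sum>i\<in>S. f i x) powr p = (LINT x:B|lborel. norm (\<Sum>i\<in>S. f i x) powr p)"
    using p by (rule Lpn_powr)
  also have "\<dots> \<le> (LINT x:B|lborel. real (card S) powr (p - 1) * (\<Sum>i\<in>S. norm (f i x) powr p))"
    using sum int_sum norm_sum_powr_le[OF assms(1,2)]
    by (intro set_integral_mono) (auto simp: Lp_on_def)
  also have "\<dots> = real (card S) powr (p - 1) * (\<Sum>i\<in>S. Lpn p B (f i) powr p)"
    using set_integral_sum(2)[OF assms(1) int] p by (simp add: Lpn_powr)
  finally show "Lpn p B (\<lambda>x. \<Sum>i\<in>S. f i x) powr p \<le>
      real (card S) powr (p - 1) * (\<Sum>i\<in>S. Lpn p B (f i) powr p)" .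
qed

lemma Lpn_sum_le_card_mult:
  assumes "finite S" "1 \<le> p" "B \<in> sets lborel" "\<And>i. i \<in> S \<Longrightarrow> Lp_on p B (f i)"
    and le: "\<And>i. i \<in> S \<Longrightarrow> Lpn p B (f i) \<le> X"
  shows "Lpn p B (\<lambda>x. \<Sum>i\<in>S. f i x) \<le> real (card S) * X"
proof (cases "S = {}")
  case True
  then show ?thesis by (simp add: Lpn_def)
next
  case False
  have p: "0 < p" using assms(2) by simp
  obtain i where "i \<in> S" using False by blast
  then have X: "0 \<le> X" using le Lpn_nonneg[of p B "f i"] by fastforce
  have "Lpn p B (\<lambda>x. \<Sum>i\<in>S. f i x) powr p \<le>
      real (card S) powr (p - 1) * (\<Sum>i\<in>S. Lpn p B (f i) powr p)"
    using assms(1-4) by (rule Lpn_sum_powr_le)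
  also have "\<dots> \<le> real (card S) powr (p - 1) * (\<Sum>i\<in>S. X powr p)"
    using le p by (intro mult_left_mono sum_mono powr_mono2) (auto simp: Lpn_def)
  also have "\<dots> = (real (card S) * X) powr p"
    using False assms(1) X by (simp add: powr_diff powr_mult field_simps)
  finally have "Lpn p B (\<lambda>x. \<Sum>i\<in>S. f i x) powr p \<le> (real (card S) * X) powr p" .
  then show ?thesis by (rule powr_le_imp_le_base[OF p mult_nonneg_nonneg[OF of_nat_0_le_iff X]])
qed

lemma Lpn_add_le:
  assumes "1 \<le> p" "B \<in> sets lborel" "Lp_on p B f" "Lp_on p B g"
  shows "Lpn p B (\<lambda>x. f x + g x) \<le> 2 * max (Lpn p B f) (Lpn p B g)"
proof -
  have "(\<lambda>x. \<Sum>b\<in>UNIV. (if b then f else g) x) = (\<lambda>x. f x + g x)"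
    by (simp add: UNIV_bool add.commute)
  moreover have "Lpn p B (\<lambda>x. \<Sum>b\<in>UNIV. (if b then f else g) x) \<le>
      real (card (UNIV :: bool set)) * max (Lpn p B f) (Lpn p B g)"
    using assms by (intro Lpn_sum_le_card_mult) auto
  ultimately show ?thesis by simp
qed

lemma Lpn_sum_le_twice_large_part:
  assumes "1 \<le> p" "B \<in> sets lborel" "finite A" "\<And>\<alpha>. \<alpha> \<in> A \<Longrightarrow> Lp_on p B (f \<alpha>)" "S \<subseteq> A"
    and small: "\<And>\<alpha>. \<alpha> \<in> A - S \<Longrightarrow> Lpn p B (f \<alpha>) \<le> X"
    and X: "0 \<le> X" "4 * (real (card A) * X) \<le> Lpn p B (\<lambda>x. \<Sum>\<alpha>\<in>A. f \<alpha> x)"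
  shows "Lpn p B (\<lambda>x. \<Sum>\<alpha>\<in>A. f \<alpha> x) \<le> 2 * Lpn p B (\<lambda>x. \<Sum>\<alpha>\<in>S. f \<alpha> x)"
proof -
  define T where "T = Lpn p B (\<lambda>x. \<Sum>\<alpha>\<in>A. f \<alpha> x)"
  have fin: "finite S" "finite (A - S)" using assms(3,5) finite_subset by auto
  have "T = Lpn p B (\<lambda>x. (\<Sum>\<alpha>\<in>S. f \<alpha> x) + (\<Sum>\<alpha>\<in>A - S. f \<alpha> x))"
    unfolding T_def using assms(3,5) by (simp add: sum.subset_diff[of S A] add.commute)
  also have "\<dots> \<le> 2 * max (Lpn p B (\<lambda>x. \<Sum>\<alpha>\<in>S. f \<alpha> x)) (Lpn p B (\<lambda>x. \<Sum>\<alpha>\<in>A - S. f \<alpha> x))"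
    using assms(1-5) fin by (intro Lpn_add_le Lp_on_sum) auto
  finally have T: "T \<le> \<dots>" .
  have "Lpn p B (\<lambda>x. \<Sum>\<alpha>\<in>A - S. f \<alpha> x) \<le> real (card (A - S)) * X"
    using assms(1,2,4) fin small by (intro Lpn_sum_le_card_mult) auto
  also have "\<dots> \<le> T / 4"
  proof -
    have "real (card (A - S)) * X \<le> real (card A) * X"
      using assms(3) X(1) by (intro mult_right_mono) (auto intro: card_mono)
    then show ?thesis using X(2) unfolding T_def by linarith
  qed
  finally show ?thesis using T Lpn_nonneg[of p B "\<lambda>x. \<Sum>\<alpha>\<in>S. f \<alpha> x"] unfolding T_def
    by (auto simp: max_def split: if_splits)
qed

lemma freq_restrict_measurable:
  fixes G :: "R3 \<Rightarrow> complex"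
  assumes "G \<in> borel_measurable lborel" "\<alpha> \<in> sets borel"
  shows "(\<lambda>\<omega>. if (fst \<omega>, fst (snd \<omega>)) \<in> \<alpha> then G \<omega> else 0) \<in> borel_measurable lborel"
proof -
  have "(\<lambda>\<omega>::R3. (fst \<omega>, fst (snd \<omega>))) \<in> borel_measurable lborel"
    by (simp add: borel_measurable_continuous_onI continuous_intros)
  from measurable_sets[OF this assms(2)]
  have "{\<omega> :: R3 \<in> space lborel. (fst \<omega>, fst (snd \<omega>)) \<in> \<alpha>} \<in> sets lborel"
    by (simp add: vimage_def)
  then show ?thesis using assms(1) by (intro measurable_If) auto
qed

lemma integrable_freq_restrict:
  fixes G :: "R3 \<Rightarrow> complex"
  assumes "integrable lborel G" "\<alpha> \<in> sets borel"
  shows "integrable lborel (\<lambda>\<omega>. if (fst \<omega>, fst (snd \<omega>)) \<in> \<alpha> then G \<omega> else 0)"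
  using assms(1)
proof (rule Bochner_Integration.integrable_bound)
  show "(\<lambda>\<omega>. if (fst \<omega>, fst (snd \<omega>)) \<in> \<alpha> then G \<omega> else 0) \<in> borel_measurable lborel"
    using borel_measurable_integrable[OF assms(1)] assms(2) by (rule freq_restrict_measurable)
qed auto

lemma integrable_invft_integrand:
  fixes H :: "R3 \<Rightarrow> complex"
  assumes "integrable lborel H"
  shows "integrable lborel (\<lambda>\<omega>. H \<omega> * cis (2 * pi * (x \<bullet> \<omega>)))"
  using assms
proof (rule Bochner_Integration.integrable_bound)
  have "(\<lambda>\<omega>::R3. cis (2 * pi * (x \<bullet> \<omega>))) \<in> borel_measurable lborel"
    by (simp add: borel_measurable_continuous_onI continuous_intros)
  with borel_measurable_integrable[OF assms]
  show "(\<lambda>\<omega>. H \<omega> * cis (2 * pi * (x \<bullet> \<omega>))) \<in> borel_measurable lborel"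
    by (rule borel_measurable_times)
qed (simp add: norm_mult)

lemma invft_measurable:
  assumes "integrable lborel H"
  shows "invft H \<in> borel_measurable lborel"
  unfolding invft_def
proof (rule lborel.borel_measurable_lebesgue_integral)
  have [measurable]: "H \<in> borel_measurable lborel"
    using assms by (rule borel_measurable_integrable)
  have "(\<lambda>z::R3 \<times> R3. cis (2 * pi * (fst z \<bullet> snd z))) \<in> borel_measurable borel"
    by (simp add: borel_measurable_continuous_onI continuous_intros)
  then have "(\<lambda>z::R3 \<times> R3. cis (2 * pi * (fst z \<bullet> snd z))) \<in> borel_measurable (lborel \<Otimes>\<^sub>M lborel)"
    by (simp add: measurable_cong_sets[OF sets_pair_measure_cong[OF sets_lborel sets_lborel] refl]
        borel_prod)
  moreover have "(\<lambda>z::R3 \<times> R3. H (snd z)) \<in> borel_measurable (lborel \<Otimes>\<^sub>M lborel)"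
    by measurable
  ultimately show "(\<lambda>(x, \<omega>). H \<omega> * cis (2 * pi * (x \<bullet> \<omega>))) \<in> borel_measurable (lborel \<Otimes>\<^sub>M lborel)"
    by (simp add: case_prod_beta borel_measurable_times)
qed

lemma norm_invft_le: "norm (invft H x) \<le> (\<integral>\<omega>. norm (H \<omega>) \<partial>lborel)"
proof -
  have "norm (invft H x) \<le> (\<integral>\<omega>. norm (H \<omega> * cis (2 * pi * (x \<bullet> \<omega>))) \<partial>lborel)"
    unfolding invft_def by (rule integral_norm_bound)
  then show ?thesis by (simp add: norm_mult)
qed

lemma Lp_on_invft:
  assumes "integrable lborel H" "B \<in> sets lborel" "emeasure lborel B < \<infinity>" "0 < p"
  shows "Lp_on p B (invft H)"
  using assms(2-4) invft_measurable[OF assms(1)]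
proof (rule Lp_on_bounded)
  show "bounded (range (invft H))"
    using norm_invft_le unfolding bounded_iff by blast
qed

lemma Lp_on_proj:
  assumes "integrable lborel G" "\<alpha> \<in> sets borel"
    and "B \<in> sets lborel" "emeasure lborel B < \<infinity>" "0 < p"
  shows "Lp_on p B (proj \<alpha> G)"
  unfolding proj_def using integrable_freq_restrict[OF assms(1,2)] assms(3-5) by (rule Lp_on_invft)

lemma invft_eq_sum_proj:
  fixes G :: "R3 \<Rightarrow> complex" and A :: "R2 set set"
  assumes "finite A" "\<And>\<alpha>. \<alpha> \<in> A \<Longrightarrow> \<alpha> \<in> sets borel" "integrable lborel G"
    and partition: "AE \<omega> in lborel. G \<omega> \<noteq> 0 \<longrightarrow> card {\<alpha> \<in> A. (fst \<omega>, fst (snd \<omega>)) \<in> \<alpha>} = 1"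
  shows "invft G x = (\<Sum>\<alpha>\<in>A. proj \<alpha> G x)"
proof -
  define R where "R \<alpha> \<omega> = (if (fst \<omega>, fst (snd \<omega>)) \<in> \<alpha> then G \<omega> else 0)" for \<alpha> \<omega>
  define e where "e \<omega> = cis (2 * pi * (x \<bullet> \<omega>))" for \<omega>
  have int: "integrable lborel (\<lambda>\<omega>. R \<alpha> \<omega> * e \<omega>)" if "\<alpha> \<in> A" for \<alpha>
    unfolding R_def e_def using assms(3) assms(2)[OF that]
    by (intro integrable_invft_integrand integrable_freq_restrict)
  have sum_R: "(\<Sum>\<alpha>\<in>A. R \<alpha> \<omega>) = of_nat (card {\<alpha> \<in> A. (fst \<omega>, fst (snd \<omega>)) \<in> \<alpha>}) * G \<omega>" for \<omega>
    unfolding R_def sum.inter_filter[OF assms(1), symmetric] by simp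
  have "(\<Sum>\<alpha>\<in>A. proj \<alpha> G x) = (\<integral>\<omega>. (\<Sum>\<alpha>\<in>A. R \<alpha> \<omega> * e \<omega>) \<partial>lborel)"
    unfolding proj_def invft_def R_def[symmetric] e_def[symmetric]
    using int by (intro Bochner_Integration.integral_sum[symmetric]) auto
  also have "\<dots> = (\<integral>\<omega>. G \<omega> * e \<omega> \<partial>lborel)"
  proof (rule integral_cong_AE)
    show "(\<lambda>\<omega>. \<Sum>\<alpha>\<in>A. R \<alpha> \<omega> * e \<omega>) \<in> borel_measurable lborel"
      using int by (intro borel_measurable_sum borel_measurable_integrable)
    show "(\<lambda>\<omega>. G \<omega> * e \<omega>) \<in> borel_measurable lborel"
      unfolding e_def using integrable_invft_integrand[OF assms(3)]
      by (rule borel_measurable_integrable)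
    show "AE \<omega> in lborel. (\<Sum>\<alpha>\<in>A. R \<alpha> \<omega> * e \<omega>) = G \<omega> * e \<omega>"
      using partition by eventually_elim (auto simp: sum_distrib_right[symmetric] sum_R)
  qed
  finally show ?thesis unfolding invft_def e_def ..
qed

lemma AE_inner_neq:
  fixes a :: "'a::euclidean_space"
  assumes "a \<noteq> 0"
  shows "AE x in lborel. a \<bullet> x \<noteq> d"
proof -
  have "negligible {x. a \<bullet> x = d}" using assms by (intro negligible_hyperplane) simp
  then have "{x. a \<bullet> x = d} \<in> null_sets lebesgue" by (simp add: negligible_iff_null_sets)
  moreover have "{x. a \<bullet> x = d} \<in> sets lborel" by (simp add: borel_closed closed_hyperplane)
  ultimately have "{x. a \<bullet> x = d} \<in> null_sets lborel" using null_sets_completion_iff by blast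
  then show ?thesis by (rule AE_not_in[THEN AE_mp]) auto
qed

lemma AE_off_grid:
  assumes "0 < K"
  shows "AE \<omega> in lborel. \<forall>i::nat. K * fst \<omega> \<noteq> real i \<and> K * fst (snd (\<omega> :: R3)) \<noteq> real i"
proof -
  have "AE \<omega> in lborel. (K, 0, 0) \<bullet> \<omega> \<noteq> real i"
    "AE \<omega> in lborel. (0, K, 0) \<bullet> \<omega> \<noteq> real i" for i :: nat
    using assms by (auto intro!: AE_inner_neq simp: zero_prod_def)
  then show ?thesis by (auto simp: AE_all_countable inner_prod_def intro: AE_conjI)
qed

lemma invft_eq_sum_proj_squares:
  fixes G :: "R3 \<Rightarrow> complex"
  assumes K: "1 \<le> K" and G: "integrable lborel G" and supp: "\<forall>\<omega>. \<omega> \<notin> Nbhd \<delta> \<longrightarrow> G \<omega> = 0"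
  shows "invft G x = (\<Sum>\<alpha>\<in>squares K. proj \<alpha> G x)"
proof (rule invft_eq_sum_proj[OF _ _ G])
  show "finite (squares K)" by (rule finite_squares)
  show "\<alpha> \<in> sets borel" if "\<alpha> \<in> squares K" for \<alpha>
    using that by (rule squares_sets_borel)
  have supp_in: "(fst \<omega>, fst (snd \<omega>)) \<in> {0..1} \<times> {0..1}" if "G \<omega> \<noteq> 0" for \<omega>
  proof -
    have "\<omega> \<in> Nbhd \<delta>" using supp that by blast
    then show ?thesis by (cases \<omega>) (auto simp: Nbhd_def)
  qed
  show "AE \<omega> in lborel. G \<omega> \<noteq> 0 \<longrightarrow> card {\<alpha> \<in> squares K. (fst \<omega>, fst (snd \<omega>)) \<in> \<alpha>} = 1"
  proof -
    have "0 < real K" using K by simp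
    from AE_off_grid[OF this] show ?thesis
      by eventually_elim (intro impI card_squares_containing[OF K supp_in]; simp)
  qed
qed

lemma Lpn_invft_le_twice_big_squares:
  fixes G :: "R3 \<Rightarrow> complex"
  assumes p: "1 \<le> p" and K: "1 \<le> K" and G: "integrable lborel G"
    and supp: "\<forall>\<omega>. \<omega> \<notin> Nbhd \<delta> \<longrightarrow> G \<omega> = 0"
    and B: "B \<in> sets lborel" "emeasure lborel B < \<infinity>"
  shows "Lpn p B (invft G) \<le> 2 * Lpn p B (\<lambda>x. \<Sum>\<alpha>\<in>{\<alpha> \<in> squares K.
            1 / (100 * real K ^ 2) * Lpn p B (invft G) \<le> Lpn p B (proj \<alpha> G)}. proj \<alpha> G x)"
proof -
  define T where "T = Lpn p B (invft G)"
  define X where "X = 1 / (100 * real K ^ 2) * T"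
  have F: "invft G = (\<lambda>x. \<Sum>\<alpha>\<in>squares K. proj \<alpha> G x)"
    using invft_eq_sum_proj_squares[OF K G supp] by blast
  have "T \<le> 2 * Lpn p B (\<lambda>x. \<Sum>\<alpha>\<in>{\<alpha> \<in> squares K. X \<le> Lpn p B (proj \<alpha> G)}. proj \<alpha> G x)"
    unfolding T_def F
  proof (rule Lpn_sum_le_twice_large_part[where X = X])
    show "Lp_on p B (proj \<alpha> G)" if "\<alpha> \<in> squares K" for \<alpha>
      using G squares_sets_borel[OF that] B p by (intro Lp_on_proj) auto
    have "real (card (squares K)) \<le> real K ^ 2"
      using card_squares_le[of K] by (metis of_nat_le_iff of_nat_power)
    then have "real (card (squares K)) * X \<le> real K ^ 2 * X"
      using Lpn_nonneg by (intro mult_right_mono) (auto simp: X_def T_def)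
    also have "\<dots> = T / 100" using K by (simp add: X_def)
    finally show "4 * (real (card (squares K)) * X) \<le> Lpn p B (\<lambda>x. \<Sum>\<alpha>\<in>squares K. proj \<alpha> G x)"
      using Lpn_nonneg[of p B "invft G"] by (simp add: T_def F)
  qed (use p B Lpn_nonneg in \<open>auto simp: X_def T_def finite_squares\<close>)
  then show ?thesis by (simp add: T_def X_def)
qed

lemma Lpn_invft_le_strip_or_transverse:
  fixes G :: "R3 \<Rightarrow> complex" and c :: R3
  assumes p: "2 \<le> p" and K: "1 \<le> K" and G: "integrable lborel G"
    and supp: "\<forall>\<omega>. \<omega> \<notin> Nbhd \<delta> \<longrightarrow> G \<omega> = 0"
  defines "B \<equiv> ball c (real K ^ 2)"
  defines "T \<equiv> Lpn p B (invft G)"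
  defines "Sbig \<equiv> {\<alpha> \<in> squares K. 1 / (100 * real K ^ 2) * T \<le> Lpn p B (proj \<alpha> G)}"
  shows "(\<exists>L. is_line L \<and> T \<le> 100 * Lpn p B (\<lambda>x. \<Sum>\<alpha>\<in>{\<alpha> \<in> Sbig. \<alpha> \<subseteq> strip K L}. proj \<alpha> G x))
    \<or> (\<exists>\<alpha>1\<in>squares K. \<exists>\<alpha>2\<in>squares K. \<exists>\<alpha>3\<in>squares K. transverse (1 / real K ^ 2) \<alpha>1 \<alpha>2 \<alpha>3 \<and>
         T \<le> 100 * real K ^ 2 *
           (Lpn p B (proj \<alpha>1 G) * Lpn p B (proj \<alpha>2 G) * Lpn p B (proj \<alpha>3 G)) powr (1 / 3))"
proof -
  have "emeasure lborel B < \<infinity>"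
    unfolding B_def by (rule emeasure_bounded_finite) simp
  then have big: "T \<le> 2 * Lpn p B (\<lambda>x. \<Sum>\<alpha>\<in>Sbig. proj \<alpha> G x)"
    unfolding T_def Sbig_def using p K G supp
    by (intro Lpn_invft_le_twice_big_squares) (auto simp: B_def)
  have "Sbig \<subseteq> squares K" unfolding Sbig_def by blast
  from squares_in_strip_or_transverse[OF K this] show ?thesis
  proof (elim disjE exE conjE bexE)
    fix L assume L: "is_line L" "\<forall>\<alpha>\<in>Sbig. \<alpha> \<subseteq> strip K L"
    then have "{\<alpha> \<in> Sbig. \<alpha> \<subseteq> strip K L} = Sbig" by blast
    then show ?thesis using L(1) big Lpn_nonneg[of p B "\<lambda>x. \<Sum>\<alpha>\<in>Sbig. proj \<alpha> G x"] by auto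
  next
    fix \<alpha>1 \<alpha>2 \<alpha>3 assume \<alpha>: "\<alpha>1 \<in> Sbig" "\<alpha>2 \<in> Sbig" "\<alpha>3 \<in> Sbig"
      and "transverse (1 / real K ^ 2) \<alpha>1 \<alpha>2 \<alpha>3"
    have "1 / (100 * real K ^ 2) * T \<le>
        (Lpn p B (proj \<alpha>1 G) * Lpn p B (proj \<alpha>2 G) * Lpn p B (proj \<alpha>3 G)) powr (1 / 3)"
      using \<alpha> by (intro le_cube_root_prod) (auto simp: Sbig_def T_def Lpn_nonneg)
    then show ?thesis using K \<alpha> \<open>transverse _ _ _ _\<close> by (auto simp: Sbig_def field_simps)
  qed
qed

theorem proposition4p1:
  fixes p \<delta> :: real
  assumes "p \<ge> 2" and "\<delta> > 0"
  shows "\<exists>C>0. \<forall>(K::nat) (G :: R3 \<Rightarrow> complex) (c :: R3).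
    K \<ge> 1 \<longrightarrow> integrable lborel G \<longrightarrow> (\<forall>\<omega>. \<omega> \<notin> Nbhd \<delta> \<longrightarrow> G \<omega> = 0) \<longrightarrow>
    (let F = invft G; B = ball c (real K ^ 2);
         Sbig = {\<alpha> \<in> squares K. Lpn p B (proj \<alpha> G) \<ge> 1 / (100 * real K ^ 2) * Lpn p B F} in
      Lpn p B F \<le> C * Max ((\<lambda>\<alpha>. Lpn p B (proj \<alpha> G)) ` squares K)
    \<or> (\<exists>L. is_line L \<and>
         Lpn p B F \<le> C * Lpn p B (\<lambda>x. \<Sum>\<alpha>\<in>{\<alpha> \<in> Sbig. \<alpha> \<subseteq> strip K L}. proj \<alpha> G x))
    \<or> (\<exists>\<alpha>1\<in>squares K. \<exists>\<alpha>2\<in>squares K. \<exists>\<alpha>3\<in>squares K.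
         transverse (1 / real K ^ 2) \<alpha>1 \<alpha>2 \<alpha>3 \<and>
         Lpn p B F \<le> C * real K ^ 2 *
           (Lpn p B (proj \<alpha>1 G) * Lpn p B (proj \<alpha>2 G) * Lpn p B (proj \<alpha>3 G)) powr (1 / 3)))"
  by (intro exI[of _ "100 :: real"] conjI allI impI, simp, unfold Let_def, rule disjI2)
    (rule Lpn_invft_le_strip_or_transverse[OF assms(1)])

end
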